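(* Let $f=\{f_n:\{0,1\}^n\to\{0,1\}^n\}_{n\in\mathbb{N}}$ be an $s(n)$-secure quantum one-way function family, where $s(n)=n^{\omega(1)}$. Then there exists $t=t_0\in[1,n]$ such that Protocol 1 with parameters $t_0$ and $\Delta_1=\Delta_2=\frac14\log s(n)$ is $(1/n)$-hiding.
   Context: $U_n$ is uniform on $\{0,1\}^n$. $f$ is $s(n)$-secure quantum one-way if $f_n$ is computable exactly by a polynomial-size quantum circuit family and for every polynomial-size quantum circuit family $\{\mathcal{B}_n\}$ and all large $n$, $\Pr[f_n(\mathcal{B}_n(f_n(U_n)))=f_n(U_n)]<1/s(n)$. $s(n)=n^{\omega(1)}$ means $s$ eventually exceeds every polynomial. Bases: $|b\rangle_+$ computational, $|0\rangle_\times=(|0\rangle+|1\rangle)/\sqrt2$, $|1\rangle_\times=(|0\rangle-|1\rangle)/\sqrt2$, $|z\rangle_\theta=\bigotimes_i|z_i\rangle_\theta$, $\theta(0)=+$, $\theta(1)=\times$. A family $H$ of functions $\{0,1\}^a\to\{0,1\}^b$ is pairwise independent if for distinct $x,x'$ and any $y,y'$, $\Pr_h[h(x)=y\wedge h(x')=y']=2^{-2b}$; hash functions are described by fixed-length bit strings. Protocol 1 (parameters $t\in[1,n]$, $\Delta_1\in[0,t]$, $\Delta_2\in[0,n-t]$; $H^{(1)}$ pairwise independent from $\{0,1\}^n$ to $\{0,1\}^{t-\Delta_1}$, $H^{(2)}$ from $\{0,1\}^n$ to $\{0,1\}^{n-t-\Delta_2}$), commit phase: Alice, holding bits $w_1,w_2$,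 chooses uniform $x\in\{0,1\}^n$, picks uniform $h_1\in H^{(1)}$, $h_2\in H^{(2)}$, and sends Bob $|h_1,h_1(f_n(x))\rangle_{\theta(w_1)}\otimes|h_2,h_2(x)\rangle_{\theta(w_2)}$. $\gamma$-hiding: there is a subset $\Gamma\subseteq\{0,1\}^n$ with $|\Gamma|\ge\gamma 2^n$ such that, letting $\rho(w_1,w_2)$ denote Bob's state (mixture of $|h,h(f_n(x))\rangle_{\theta(w_1)}\otimes|h',h'(x)\rangle_{\theta(w_2)}$ over uniform $h\in H^{(1)}$, $h'\in H^{(2)}$ and $x$ uniform in $\Gamma$), the four states $\rho(0,0),\rho(0,1),\rho(1,0),\rho(1,1)$ are pairwise at negligible trace distance $\frac12\mathrm{tr}|\rho-\sigma|$. *)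

theory Defs
  imports "HOL-Analysis.Analysis" "Jordan_Normal_Form.Spectral_Radius"
begin

definition strs :: "nat \<Rightarrow> bool list set" where
  "strs n = {xs. length xs = n}"

(* little-endian encoding of bit strings as basis indices *)
definition bitof :: "nat \<Rightarrow> nat \<Rightarrow> bool" where
  "bitof r j = odd (r div 2 ^ j)"

definition bitsof :: "nat \<Rightarrow> nat \<Rightarrow> bool list" where
  "bitsof k r = map (bitof r) [0..<k]"

definition idx :: "bool list \<Rightarrow> nat" where
  "idx xs = (\<Sum>i<length xs. if xs ! i then 2 ^ i else 0)"

definition flip :: "nat \<Rightarrow> nat \<Rightarrow> nat" where
  "flip r j = (if bitof r j then r - 2 ^ j else r + 2 ^ j)"

datatype gate = Had nat | Tg nat | CNOT nat nat | Toffoli nat nat nat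

record qcirc =
  qubits :: nat
  gates :: "gate list"

fun wf_gate :: "nat \<Rightarrow> gate \<Rightarrow> bool" where
  "wf_gate m (Had i) = (i < m)"
| "wf_gate m (Tg i) = (i < m)"
| "wf_gate m (CNOT a b) = (a < m \<and> b < m \<and> a \<noteq> b)"
| "wf_gate m (Toffoli a b c) = (a < m \<and> b < m \<and> c < m \<and> distinct [a, b, c])"

fun gate_entry :: "nat \<Rightarrow> gate \<Rightarrow> nat \<Rightarrow> nat \<Rightarrow> complex" where
  "gate_entry m (Had i) r c =
     (if (\<forall>j<m. j \<noteq> i \<longrightarrow> bitof r j = bitof c j)
      then (if bitof r i \<and> bitof c i then -1 else 1) / complex_of_real (sqrt 2) else 0)"
| "gate_entry m (Tg i) r c = (if r = c then (if bitof r i then cis (pi / 4) else 1) else 0)"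
| "gate_entry m (CNOT a b) r c = (if r = (if bitof c a then flip c b else c) then 1 else 0)"
| "gate_entry m (Toffoli a b t) r c =
     (if r = (if bitof c a \<and> bitof c b then flip c t else c) then 1 else 0)"

definition apply_gate :: "nat \<Rightarrow> gate \<Rightarrow> (nat \<Rightarrow> complex) \<Rightarrow> (nat \<Rightarrow> complex)" where
  "apply_gate m g \<psi> = (\<lambda>r. \<Sum>c<2 ^ m. gate_entry m g r c * \<psi> c)"

(* final state on input x: x on wires 0..|x|-1, ancillas initialised to 0 *)
definition run :: "qcirc \<Rightarrow> bool list \<Rightarrow> (nat \<Rightarrow> complex)" where
  "run C x = fold (apply_gate (qubits C)) (gates C) (\<lambda>r. if r = idx x then 1 else 0)"

definition out_prob :: "qcirc \<Rightarrow> bool list \<Rightarrow> bool list \<Rightarrow> real" where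
  "out_prob C x z =
     (\<Sum>r\<in>{r. r < 2 ^ qubits C \<and> take (length z) (bitsof (qubits C) r) = z}. (cmod (run C x r))\<^sup>2)"

definition csize :: "qcirc \<Rightarrow> nat" where
  "csize C = qubits C + length (gates C)"

(* circuit with n input bits and k output bits *)
definition wf_circ :: "nat \<Rightarrow> nat \<Rightarrow> qcirc \<Rightarrow> bool" where
  "wf_circ n k C = ((\<forall>g\<in>set (gates C). wf_gate (qubits C) g) \<and> n \<le> qubits C \<and> k \<le> qubits C)"

definition poly_size :: "(nat \<Rightarrow> qcirc) \<Rightarrow> bool" where
  "poly_size C = (\<exists>c::nat. \<forall>n. csize (C n) \<le> (n + 2) ^ c)"

definition computes_exactly :: "(nat \<Rightarrow> bool list \<Rightarrow> bool list) \<Rightarrow> (nat \<Rightarrow> qcirc) \<Rightarrow> bool" where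
  "computes_exactly f C =
     (\<forall>n. wf_circ n n (C n) \<and> (\<forall>x\<in>strs n. out_prob (C n) x (f n x) = 1))"

definition inv_succ :: "(nat \<Rightarrow> bool list \<Rightarrow> bool list) \<Rightarrow> (nat \<Rightarrow> qcirc) \<Rightarrow> nat \<Rightarrow> real" where
  "inv_succ f B n =
     (\<Sum>x\<in>strs n. \<Sum>z\<in>strs n. if f n z = f n x then out_prob (B n) (f n x) z else 0) / 2 ^ n"

definition quantum_owf :: "(nat \<Rightarrow> real) \<Rightarrow> (nat \<Rightarrow> bool list \<Rightarrow> bool list) \<Rightarrow> bool" where
  "quantum_owf s f =
     ((\<forall>n. \<forall>x\<in>strs n. length (f n x) = n) \<and>
      (\<exists>C. poly_size C \<and> computes_exactly f C) \<and>
      (\<forall>B. poly_size B \<and> (\<forall>n. wf_circ n n (B n)) \<longrightarrow>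
           (\<forall>\<^sub>F n in sequentially. inv_succ f B n < 1 / s n)))"

definition superpoly :: "(nat \<Rightarrow> real) \<Rightarrow> bool" where
  "superpoly s = (\<forall>c::nat. \<forall>\<^sub>F n in sequentially. real n ^ c < s n)"

definition negligible :: "(nat \<Rightarrow> real) \<Rightarrow> bool" where
  "negligible \<epsilon> = (\<forall>c::nat. \<forall>\<^sub>F n in sequentially. \<bar>\<epsilon> n\<bar> < 1 / real n ^ c)"

definition pairwise_indep :: "nat \<Rightarrow> nat \<Rightarrow> nat \<Rightarrow> (bool list \<Rightarrow> bool list \<Rightarrow> bool list) \<Rightarrow> bool" where
  "pairwise_indep L a b E =
     ((\<forall>d\<in>strs L. \<forall>x\<in>strs a. length (E d x) = b) \<and>
      (\<forall>x\<in>strs a. \<forall>x'\<in>strs a. \<forall>y\<in>strs b. \<forall>y'\<in>strs b. x \<noteq> x' \<longrightarrow>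
          real (card {d\<in>strs L. E d x = y \<and> E d x' = y'}) / 2 ^ L = 1 / 2 ^ (2 * b)))"

(* amplitude <u | z>_theta ; theta = False is the computational basis +, True is the Hadamard basis x *)
definition amp :: "bool \<Rightarrow> bool list \<Rightarrow> bool list \<Rightarrow> complex" where
  "amp \<theta> z u =
     (if \<not> \<theta> then (if u = z then 1 else 0)
      else (\<Prod>i<length z. if u ! i \<and> z ! i then -1 else 1) / complex_of_real (sqrt 2 ^ length z))"

definition trace_norm :: "nat \<Rightarrow> (nat \<Rightarrow> nat \<Rightarrow> complex) \<Rightarrow> real" where
  "trace_norm d M =
     (let B = mat d d (\<lambda>(i, j). \<Sum>k<d. cnj (M k i) * M k j)
      in \<Sum>\<mu>\<in>spectrum B. real (order \<mu> (char_poly B)) * sqrt (Re \<mu>))"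

definition trace_dist :: "nat \<Rightarrow> (nat \<Rightarrow> nat \<Rightarrow> complex) \<Rightarrow> (nat \<Rightarrow> nat \<Rightarrow> complex) \<Rightarrow> real" where
  "trace_dist d \<rho> \<sigma> = trace_norm d (\<lambda>i j. \<rho> i j - \<sigma> i j) / 2"

definition Delta :: "(nat \<Rightarrow> real) \<Rightarrow> nat \<Rightarrow> nat" where
  "Delta s n = nat \<lfloor>log 2 (s n) / 4\<rfloor>"

(* register lengths: h1 description, h1 output, h2 description, h2 output *)
definition bob_dim :: "(nat \<Rightarrow> nat \<Rightarrow> nat) \<Rightarrow> (nat \<Rightarrow> nat \<Rightarrow> nat) \<Rightarrow> nat \<Rightarrow> nat \<Rightarrow> nat \<Rightarrow> nat \<Rightarrow> nat" where
  "bob_dim L1 L2 n t D1 D2 =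
     L1 n (t - D1) + (t - D1) + L2 n (n - t - D2) + (n - t - D2)"

definition bob_rho ::
  "(nat \<Rightarrow> bool list \<Rightarrow> bool list) \<Rightarrow>
   (nat \<Rightarrow> nat \<Rightarrow> nat) \<Rightarrow> (nat \<Rightarrow> nat \<Rightarrow> bool list \<Rightarrow> bool list \<Rightarrow> bool list) \<Rightarrow>
   (nat \<Rightarrow> nat \<Rightarrow> nat) \<Rightarrow> (nat \<Rightarrow> nat \<Rightarrow> bool list \<Rightarrow> bool list \<Rightarrow> bool list) \<Rightarrow>
   nat \<Rightarrow> nat \<Rightarrow> nat \<Rightarrow> nat \<Rightarrow> bool list set \<Rightarrow> bool \<Rightarrow> bool \<Rightarrow> nat \<Rightarrow> nat \<Rightarrow> complex" where
  "bob_rho f L1 E1 L2 E2 n t D1 D2 Gam w1 w2 =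
     (let b1 = t - D1; b2 = n - t - D2; l1 = L1 n b1; l2 = L2 n b2;
          D = bob_dim L1 L2 n t D1 D2;
          \<psi> = (\<lambda>x d1 d2 r.
                 let u = bitsof D r in
                 amp w1 (d1 @ E1 n b1 d1 (f n x)) (take (l1 + b1) u) *
                 amp w2 (d2 @ E2 n b2 d2 x) (drop (l1 + b1) u))
      in (\<lambda>r c. (\<Sum>x\<in>Gam. \<Sum>d1\<in>strs l1. \<Sum>d2\<in>strs l2. \<psi> x d1 d2 r * cnj (\<psi> x d1 d2 c))
                 / of_real (real (card Gam) * 2 ^ l1 * 2 ^ l2)))"

end

theory Submission
  imports Defs
begin

text \<open>
  The hiding is statistical. In every basis choice Bob's state is a uniform mixture of basis vectors
  of an orthonormal basis, so its squared Frobenius distance to the maximally mixed state depends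
  only on the collision probability of the encoded classical string, not on the bases. By
  Cauchy-Schwarz on the singular values, the trace distance between two such states is therefore
  controlled by the collision probability, as in the leftover hash lemma.

  On a set \<open>G\<close> of at least \<open>2 ^ n / n\<close> inputs whose \<open>f\<close>-fibers have size about \<open>2 ^ (n - t)\<close>
  (pigeonhole over \<open>t\<close>), the collision probability exceeds the uniform one by a relative error
  \<open>O(n / 2 ^ Delta)\<close>. This needs \<open>Delta \<le> t0 \<le> n - Delta\<close> and \<open>t0 \<le> t\<close>, so \<open>t0 = min t (n - Delta)\<close>:
  for nearly injective \<open>f\<close>, \<open>t\<close> itself is too large. One-wayness is used only against the circuit
  that outputs a uniform string: it rules out that \<open>t < Delta\<close>, that \<open>4 * Delta \<ge> n\<close> and that
  \<open>f\<close> is constant.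
\<close>

section \<open>Trace norm and Frobenius norm\<close>

lemma sum_count_list:
  fixes g :: "'a \<Rightarrow> real"
  assumes "finite X" "set xs \<subseteq> X"
  shows "(\<Sum>x\<in>X. count_list xs x * g x) = (\<Sum>x\<leftarrow>xs. g x)"
  using assms(2)
proof (induction xs)
  case (Cons a xs)
  have "(\<Sum>x\<in>X. count_list (a # xs) x * g x)
    = (\<Sum>x\<in>X. count_list xs x * g x + (if a = x then g x else 0))"
    by (intro sum.cong refl) (simp add: distrib_right)
  then show ?case using Cons assms(1) by (simp add: sum.distrib sum.delta')
qed simp

text \<open>\<open>trace_norm\<close> counts eigenvalues with algebraic multiplicity. Reading the
  multiplicity as a list count turns its sum over the spectrum into a sum over all \<open>d\<close>
  eigenvalues.\<close>

lemma order_prod_list_linear: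
  fixes x :: "'a::{idom,ring_char_0}"
  shows "order x (\<Prod>a\<leftarrow>es. [:- a, 1:]) = count_list es x"
proof (induction es)
  case (Cons a es)
  have "(\<Prod>a\<leftarrow>es. [:- a, 1:]) \<noteq> 0"
    by (auto simp: prod_list_zero_iff)
  then have "order x (\<Prod>a\<leftarrow>a # es. [:- a, 1:]) = order x [:- a, 1:] + count_list es x"
    by (simp add: order_mult Cons.IH del: mult_pCons_left)
  moreover have "order x [:- a, 1:] = (if a = x then 1 else 0)"
    using order_linear_power[of x "- a" 1] by auto
  ultimately show ?case by simp
qed simp

text \<open>Schur triangularization writes \<open>A\<close> as \<open>P * B * Q\<close> with
  \<open>Q * P\<close> the identity and \<open>es\<close> on the diagonal of \<open>B\<close>.
  Cyclicity of the trace then moves \<open>P\<close> to the right end, where it cancels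
  \<open>Q\<close>.\<close>

lemma diag_sum_eq_sum_eigenvalues:
  fixes A :: "complex mat"
  assumes A: "A \<in> carrier_mat n n" and es: "char_poly A = (\<Prod>e\<leftarrow>es. [:- e, 1:])"
  shows "(\<Sum>i<n. A $$ (i, i)) = sum_list es"
proof -
  obtain B P Q where dec: "schur_decomposition A es = (B, P, Q)"
    by (cases "schur_decomposition A es")
  from schur_decomposition[OF A es dec]
  have sim: "similar_mat_wit A B P Q" and diag: "diag_mat B = es" by auto
  note w = similar_mat_witD2[OF A sim]
  have ent: "(\<Sum>i<n. (X * Y) $$ (i, i)) = (\<Sum>i<n. \<Sum>k<n. X $$ (i, k) * Y $$ (k, i))"
    if "X \<in> carrier_mat n n" "Y \<in> carrier_mat n n" for X Y :: "complex mat"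
    using that by (intro sum.cong) (auto simp: scalar_prod_def atLeast0LessThan)
  have comm: "(\<Sum>i<n. (X * Y) $$ (i, i)) = (\<Sum>i<n. (Y * X) $$ (i, i))"
    if "X \<in> carrier_mat n n" "Y \<in> carrier_mat n n" for X Y :: "complex mat"
    unfolding ent[OF that] ent[OF that(2,1)]
    by (subst sum.swap) (simp add: mult.commute)
  have "(\<Sum>i<n. A $$ (i, i)) = (\<Sum>i<n. (P * (B * Q)) $$ (i, i))"
    using w by (simp add: assoc_mult_mat[of P n n B n Q n])
  also have "\<dots> = (\<Sum>i<n. (B * Q * P) $$ (i, i))"
    using w by (intro comm) auto
  also have "\<dots> = (\<Sum>i<n. B $$ (i, i))"
    using w by (simp add: assoc_mult_mat[of B n n Q n P n])
  also have "\<dots> = sum_list (diag_mat B)"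
    using w by (simp add: diag_mat_def sum_list_distinct_conv_sum_set atLeast0LessThan)
  finally show ?thesis using diag by simp
qed

text \<open>For an eigenvector \<open>v\<close> of \<open>M* M\<close>, pairing with
  \<open>v\<close> gives \<open>\<mu> |v|^2 = |M v|^2\<close>.\<close>

lemma eigenvalue_gram_nonneg:
  assumes ev: "eigenvalue (mat d d (\<lambda>(i, j). \<Sum>k<d. cnj (M k i) * M k j)) \<mu>"
  shows "0 \<le> Re \<mu>"
proof -
  let ?B = "mat d d (\<lambda>(i, j). \<Sum>k<d. cnj (M k i) * M k j)"
  obtain v where v: "v \<in> carrier_vec d" "v \<noteq> 0\<^sub>v d" and ev: "?B *\<^sub>v v = \<mu> \<cdot>\<^sub>v v"
    using ev unfolding eigenvalue_def eigenvector_def by auto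
  have row: "(\<Sum>j<d. (\<Sum>k<d. cnj (M k i) * M k j) * v $ j) = \<mu> * v $ i" if "i < d" for i
  proof -
    have "(?B *\<^sub>v v) $ i = \<mu> * v $ i" using ev that v by simp
    then show ?thesis using that v by (simp add: scalar_prod_def atLeast0LessThan)
  qed
  have "\<mu> * of_real (\<Sum>i<d. (cmod (v $ i))\<^sup>2) = (\<Sum>i<d. cnj (v $ i) * (\<mu> * v $ i))"
    by (simp add: sum_distrib_left complex_norm_square mult_ac del: of_real_power)
  also have "\<dots> = (\<Sum>i<d. cnj (v $ i) * (\<Sum>j<d. (\<Sum>k<d. cnj (M k i) * M k j) * v $ j))"
    using row by (intro sum.cong) auto
  also have "\<dots> = (\<Sum>i<d. \<Sum>j<d. \<Sum>k<d. cnj (M k i) * M k j * v $ j * cnj (v $ i))"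
    by (simp add: sum_distrib_left sum_distrib_right mult_ac)
  also have "\<dots> = (\<Sum>i<d. \<Sum>k<d. \<Sum>j<d. cnj (M k i) * M k j * v $ j * cnj (v $ i))"
    by (intro sum.cong refl sum.swap)
  also have "\<dots> = (\<Sum>k<d. \<Sum>i<d. \<Sum>j<d. cnj (M k i) * M k j * v $ j * cnj (v $ i))"
    by (rule sum.swap)
  also have "\<dots> = (\<Sum>k<d. cnj (\<Sum>i<d. M k i * v $ i) * (\<Sum>j<d. M k j * v $ j))"
    unfolding cnj_sum sum_product by (simp add: mult_ac)
  also have "\<dots> = of_real (\<Sum>k<d. (cmod (\<Sum>j<d. M k j * v $ j))\<^sup>2)"
    by (simp add: complex_norm_square mult_ac del: of_real_power)
  finally have "Re (\<mu> * of_real (\<Sum>i<d. (cmod (v $ i))\<^sup>2)) \<ge> 0"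
    by (simp add: sum_nonneg)
  then have "0 \<le> Re \<mu> * (\<Sum>i<d. (cmod (v $ i))\<^sup>2)" by simp
  moreover have "(\<Sum>i<d. (cmod (v $ i))\<^sup>2) > 0"
  proof -
    obtain i where "i < d" "v $ i \<noteq> 0" using v by (metis eq_vecI carrier_vecD index_zero_vec)
    then show ?thesis by (intro sum_pos2[of _ i]) auto
  qed
  ultimately show ?thesis by (simp add: zero_le_mult_iff)
qed

text \<open>Allows the absolute value in \<open>negligible\<close> to be dropped for trace
  distances.\<close>

lemma trace_norm_nonneg: "0 \<le> trace_norm d M"
  unfolding trace_norm_def Let_def
  by (intro sum_nonneg mult_nonneg_nonneg)
     (auto simp: spectrum_def intro: eigenvalue_gram_nonneg)

text \<open>The trace norm is the sum of the \<open>d\<close> singular values. Cauchy-Schwarz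
  against the all-ones vector bounds it by \<open>sqrt d\<close> times their Euclidean length, which
  is the Frobenius norm because the trace of \<open>M* M\<close> is the sum of the squared singular
  values.\<close>

lemma trace_norm_le_frobenius:
  "trace_norm d M \<le> sqrt (real d * (\<Sum>i<d. \<Sum>j<d. (cmod (M i j))\<^sup>2))"
proof -
  let ?B = "mat d d (\<lambda>(i, j). \<Sum>k<d. cnj (M k i) * M k j)"
  have B: "?B \<in> carrier_mat d d" by simp
  obtain es where es: "char_poly ?B = (\<Prod>e\<leftarrow>es. [:- e, 1:])" and len: "length es = d"
    using char_poly_factorized[OF B] by auto
  have spec: "spectrum ?B = set es"
    unfolding spectrum_def using eigenvalue_root_char_poly[OF B] 
    by (auto simp: es poly_prod_list prod_list_zero_iff o_def)
  have nn: "0 \<le> Re \<mu>" if "\<mu> \<in> set es" for \<mu>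
    using that spec eigenvalue_gram_nonneg[of d M \<mu>] unfolding spectrum_def by blast
  have "(\<Sum>i<d. ?B $$ (i, i)) = of_real (\<Sum>i<d. \<Sum>k<d. (cmod (M k i))\<^sup>2)"
    by (simp add: complex_norm_square mult_ac del: of_real_power)
  then have tr: "Re (sum_list es) = (\<Sum>i<d. \<Sum>j<d. (cmod (M i j))\<^sup>2)"
    unfolding diag_sum_eq_sum_eigenvalues[OF B es] by (subst sum.swap) simp
  have "trace_norm d M = (\<Sum>\<mu>\<in>set es. count_list es \<mu> * sqrt (Re \<mu>))"
    unfolding trace_norm_def Let_def spec es order_prod_list_linear ..
  also have "\<dots> = (\<Sum>e\<leftarrow>es. sqrt (Re e))"
    by (rule sum_count_list) auto
  also have "\<dots> = (\<Sum>i<d. 1 * sqrt (Re (es ! i)))"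
    by (simp add: sum_list_sum_nth len atLeast0LessThan)
  also have "\<dots> \<le> L2_set (\<lambda>_. 1) {..<d} * L2_set (\<lambda>i. sqrt (Re (es ! i))) {..<d}"
    using L2_set_mult_ineq[of "\<lambda>_. 1" "\<lambda>i. sqrt (Re (es ! i))" "{..<d}"] nn len by simp
  also have "\<dots> = sqrt (real d * (\<Sum>i<d. Re (es ! i)))"
    using nn len by (simp add: L2_set_def real_sqrt_mult)
  also have "(\<Sum>i<d. Re (es ! i)) = Re (sum_list es)"
    by (simp add: sum_list_sum_nth len atLeast0LessThan)
  finally show ?thesis unfolding tr .
qed

text \<open>A triangle inequality through the reference matrix \<open>\<tau>\<close>, in the squared
  form \<open>(x + y)^2 <= 2 x^2 + 2 y^2\<close>. The resulting factor 4 under the root cancels the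
  one half in \<open>trace_dist\<close>.\<close>

lemma trace_dist_le_frobenius:
  assumes "real d * (\<Sum>r<d. \<Sum>c<d. (cmod (\<rho> r c - \<tau> r c))\<^sup>2) \<le> \<delta>"
    and "real d * (\<Sum>r<d. \<Sum>c<d. (cmod (\<sigma> r c - \<tau> r c))\<^sup>2) \<le> \<delta>"
  shows "trace_dist d \<rho> \<sigma> \<le> sqrt \<delta>"
proof -
  have sq: "(cmod (a - b))\<^sup>2 \<le> 2 * (cmod (a - e))\<^sup>2 + 2 * (cmod (b - e))\<^sup>2" for a b e :: complex
  proof -
    have "cmod (a - b) \<le> cmod (a - e) + cmod (b - e)"
      using norm_triangle_ineq4[of "a - e" "b - e"] by simp
    then have "(cmod (a - b))\<^sup>2 \<le> (cmod (a - e) + cmod (b - e))\<^sup>2"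
      by (intro power_mono) auto
    also have "\<dots> \<le> 2 * (cmod (a - e))\<^sup>2 + 2 * (cmod (b - e))\<^sup>2"
      using sum_squares_bound[of "cmod (a - e)" "cmod (b - e)"] by (simp add: power2_sum)
    finally show ?thesis .
  qed
  have "real d * (\<Sum>r<d. \<Sum>c<d. (cmod (\<rho> r c - \<sigma> r c))\<^sup>2)
    \<le> real d * (\<Sum>r<d. \<Sum>c<d. 2 * (cmod (\<rho> r c - \<tau> r c))\<^sup>2 + 2 * (cmod (\<sigma> r c - \<tau> r c))\<^sup>2)"
    by (intro mult_left_mono sum_mono sq) auto
  also have "\<dots> = 2 * (real d * (\<Sum>r<d. \<Sum>c<d. (cmod (\<rho> r c - \<tau> r c))\<^sup>2))
     + 2 * (real d * (\<Sum>r<d. \<Sum>c<d. (cmod (\<sigma> r c - \<tau> r c))\<^sup>2))"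
    by (simp add: sum.distrib sum_distrib_left distrib_left mult_ac)
  also have "\<dots> \<le> 4 * \<delta>" using assms by simp
  finally have "trace_norm d (\<lambda>i j. \<rho> i j - \<sigma> i j) \<le> sqrt (4 * \<delta>)"
    
    using trace_norm_le_frobenius[of d "\<lambda>i j. \<rho> i j - \<sigma> i j"] real_sqrt_le_mono order_trans by blast
  then show ?thesis unfolding trace_dist_def by (simp add: real_sqrt_mult)
qed

text \<open>The labels \<open>z\<close> name vectors of an orthonormal system, repetitions allowed.
  For the mixture \<open>\<rho>\<close>, expanding \<open>tr (\<rho> - I/d)^2\<close> with
  \<open>tr \<rho> = 1\<close> leaves \<open>tr \<rho>^2 - 1/d\<close>, and by orthonormality
  \<open>tr \<rho>^2\<close> is the probability that two independent indices carry the same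
  label.\<close>

lemma frobenius_dist_maximally_mixed:
  fixes \<psi> :: "'a \<Rightarrow> nat \<Rightarrow> complex" and z :: "'a \<Rightarrow> 'b"
  assumes fin: "finite A" and ne: "A \<noteq> {}" and d: "d > 0"
    and ortho: "\<And>a b. a \<in> A \<Longrightarrow> b \<in> A \<Longrightarrow> (\<Sum>r<d. \<psi> a r * cnj (\<psi> b r)) = of_bool (z a = z b)"
  shows "(\<Sum>r<d. \<Sum>c<d. (cmod ((\<Sum>a\<in>A. \<psi> a r * cnj (\<psi> a c)) / of_nat (card A) - of_bool (r = c) / of_nat d))\<^sup>2)
       = card {(a, b). a \<in> A \<and> b \<in> A \<and> z a = z b} / (real (card A))\<^sup>2 - 1 / real d"
proof -
  let ?N = "of_nat (card A) :: complex"
  have N: "?N \<noteq> 0" using fin ne by simp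
  define R where "R r c = (\<Sum>a\<in>A. \<psi> a r * cnj (\<psi> a c))" for r c
  have herm: "cnj (R r c) = R c r" for r c unfolding R_def by (simp add: mult.commute)
  have trR: "(\<Sum>r<d. R r r) = ?N"
  proof -
    have "(\<Sum>r<d. R r r) = (\<Sum>a\<in>A. \<Sum>r<d. \<psi> a r * cnj (\<psi> a r))"
      unfolding R_def by (rule sum.swap)
    also have "\<dots> = (\<Sum>a\<in>A. 1)" using ortho by (intro sum.cong) auto
    finally show ?thesis by simp
  qed
  have trR2: "(\<Sum>r<d. \<Sum>c<d. R r c * R c r) = of_nat (card {(a, b). a \<in> A \<and> b \<in> A \<and> z a = z b})"
  proof -
    have "(\<Sum>r<d. \<Sum>c<d. R r c * R c r)
      = (\<Sum>r<d. \<Sum>c<d. \<Sum>a\<in>A. \<Sum>b\<in>A. (\<psi> a r * cnj (\<psi> b r)) * (\<psi> b c * cnj (\<psi> a c)))"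
      unfolding R_def sum_product by (simp add: mult_ac)
    also have "\<dots> = (\<Sum>a\<in>A. \<Sum>b\<in>A. \<Sum>r<d. \<Sum>c<d. (\<psi> a r * cnj (\<psi> b r)) * (\<psi> b c * cnj (\<psi> a c)))"
    proof -
      have "(\<Sum>r<d. \<Sum>c<d. \<Sum>a\<in>A. \<Sum>b\<in>A. g r c a b) = (\<Sum>a\<in>A. \<Sum>b\<in>A. \<Sum>r<d. \<Sum>c<d. g r c a b)"
        for g :: "nat \<Rightarrow> nat \<Rightarrow> 'a \<Rightarrow> 'a \<Rightarrow> complex"
      proof -
        have "(\<Sum>r<d. \<Sum>c<d. \<Sum>a\<in>A. \<Sum>b\<in>A. g r c a b) = (\<Sum>r<d. \<Sum>a\<in>A. \<Sum>c<d. \<Sum>b\<in>A. g r c a b)"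
          by (intro sum.cong refl sum.swap)
        also have "\<dots> = (\<Sum>r<d. \<Sum>a\<in>A. \<Sum>b\<in>A. \<Sum>c<d. g r c a b)"
          by (intro sum.cong refl sum.swap)
        also have "\<dots> = (\<Sum>a\<in>A. \<Sum>r<d. \<Sum>b\<in>A. \<Sum>c<d. g r c a b)"
          by (rule sum.swap)
        also have "\<dots> = (\<Sum>a\<in>A. \<Sum>b\<in>A. \<Sum>r<d. \<Sum>c<d. g r c a b)"
          by (intro sum.cong refl sum.swap)
        finally show ?thesis .
      qed
      then show ?thesis .
    qed
    also have "\<dots> = (\<Sum>a\<in>A. \<Sum>b\<in>A. of_bool (z a = z b))"
    proof (intro sum.cong refl)
      fix a b assume ab: "a \<in> A" "b \<in> A"
      have "(\<Sum>r<d. \<Sum>c<d. (\<psi> a r * cnj (\<psi> b r)) * (\<psi> b c * cnj (\<psi> a c)))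
        = (\<Sum>r<d. \<psi> a r * cnj (\<psi> b r)) * (\<Sum>c<d. \<psi> b c * cnj (\<psi> a c))"
        by (rule sum_product[symmetric])
      also have "\<dots> = of_bool (z a = z b)" using ortho ab by simp
      finally show "(\<Sum>r<d. \<Sum>c<d. (\<psi> a r * cnj (\<psi> b r)) * (\<psi> b c * cnj (\<psi> a c))) = of_bool (z a = z b)" .
    qed
    also have "\<dots> = (\<Sum>p\<in>A \<times> A. of_bool (z (fst p) = z (snd p)))"
      by (simp add: sum.cartesian_product case_prod_beta)
    also have "\<dots> = of_nat (card ((A \<times> A) \<inter> {p. z (fst p) = z (snd p)}))"
      using fin by (simp add: sum_of_bool_eq)
    also have "(A \<times> A) \<inter> {p. z (fst p) = z (snd p)} = {(a, b). a \<in> A \<and> b \<in> A \<and> z a = z b}" by auto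
    finally show ?thesis .
  qed
  have "complex_of_real (\<Sum>r<d. \<Sum>c<d. (cmod (R r c / ?N - of_bool (r = c) / of_nat d))\<^sup>2)
     = (\<Sum>r<d. \<Sum>c<d. (R r c / ?N - of_bool (r = c) / of_nat d) * (R c r / ?N - of_bool (r = c) / of_nat d))"
    by (simp add: complex_norm_square herm of_bool_def if_distrib[of cnj] cong: if_cong del: of_real_power)
  also have "\<dots> = (\<Sum>r<d. \<Sum>c<d. R r c * R c r / ?N\<^sup>2 - (if r = c then 2 * R r c / (?N * of_nat d) - 1 / (of_nat d)\<^sup>2 else 0))"
    by (intro sum.cong refl) (auto simp: divide_inverse algebra_simps power2_eq_square)
  also have "\<dots> = (\<Sum>r<d. \<Sum>c<d. R r c * R c r) / ?N\<^sup>2 - (2 * (\<Sum>r<d. R r r) / (?N * of_nat d) - 1 / of_nat d)"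
    using d by (simp add: sum_subtractf sum_divide_distrib sum_distrib_left power2_eq_square)
  also have "\<dots> = of_real (card {(a, b). a \<in> A \<and> b \<in> A \<and> z a = z b} / (real (card A))\<^sup>2 - 1 / real d)"
    unfolding trR trR2 using N d by (simp add: field_simps)
  finally show ?thesis unfolding R_def of_real_eq_iff .
qed

section \<open>Bit strings and conjugate coding\<close>

lemma finite_strs [simp]: "finite (strs n)"
  using finite_lists_length_eq[of "UNIV :: bool set" n] by (simp add: strs_def)

lemma card_strs [simp]: "card (strs n) = 2 ^ n"
  using card_lists_length_eq[of "UNIV :: bool set" n] by (simp add: strs_def card_UNIV_bool)

lemma bitof_eq_bit: "bitof r j = bit r j"
  by (simp add: bitof_def bit_iff_odd)

lemma length_bitsof [simp]: "length (bitsof k r) = k"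
  by (simp add: bitsof_def)

lemma nat_eq_if_bits_eq:
  assumes "(r::nat) < 2 ^ m" "c < 2 ^ m" "\<And>j. j < m \<Longrightarrow> bit r j = bit c j"
  shows "r = c"
proof -
  have "take_bit m r = take_bit m c"
    using assms(3) by (auto simp: bit_eq_iff bit_take_bit_iff)
  then show ?thesis using assms by (simp add: take_bit_nat_eq_self)
qed

lemma bij_betw_bitsof: "bij_betw (bitsof k) {..<2 ^ k} (strs k)"
proof -
  have inj: "inj_on (bitsof k) {..<2 ^ k}"
    by (rule inj_onI, rule nat_eq_if_bits_eq[of _ k])
       (auto simp: bitsof_def bitof_eq_bit)
  moreover have "bitsof k ` {..<2 ^ k} = strs k"
  proof (rule card_subset_eq)
    show "bitsof k ` {..<2 ^ k} \<subseteq> strs k" by (auto simp: strs_def)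
  qed (simp_all add: card_image[OF inj])
  ultimately show ?thesis by (simp add: bij_betw_def)
qed

lemma exists_nat_with_bits:
  obtains c :: nat where "c < 2 ^ m" "\<And>j. j < m \<Longrightarrow> bit c j = Q j"
proof -
  have "map Q [0..<m] \<in> strs m" by (simp add: strs_def)
  then obtain c where c: "c < 2 ^ m" "bitsof m c = map Q [0..<m]"
    using bij_betw_bitsof[of m] by (metis bij_betw_imp_surj_on imageE lessThan_iff)
  then have "bit c j = Q j" if "j < m" for j
    using that by (simp add: bitsof_def bitof_eq_bit)
  with c show thesis using that by blast
qed

lemma strs_Suc: "strs (Suc k) = (\<lambda>(a, u). a # u) ` (UNIV \<times> strs k)"
  by (auto simp: strs_def length_Suc_conv)

lemma sum_strs_Suc: "(\<Sum>u\<in>strs (Suc k). g u) = (\<Sum>u\<in>strs k. g (False # u)) + (\<Sum>u\<in>strs k. g (True # u))"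
proof -
  have "inj_on (\<lambda>(a, u). a # u) (UNIV \<times> strs k)" by (auto simp: inj_on_def)
  then have "(\<Sum>u\<in>strs (Suc k). g u) = (\<Sum>a\<in>UNIV. \<Sum>u\<in>strs k. g (a # u))"
    unfolding strs_Suc sum.cartesian_product by (subst sum.reindex) (auto simp: case_prod_beta)
  then show ?thesis by (simp add: UNIV_bool)
qed

lemma sum_strs_append:
  "(\<Sum>w\<in>strs (k + l). g (take k w) (drop k w)) = (\<Sum>u\<in>strs k. \<Sum>v\<in>strs l. g u v)"
proof -
  have "bij_betw (\<lambda>w. (take k w, drop k w)) (strs (k + l)) (strs k \<times> strs l)"
    by (rule bij_betwI[where g = "\<lambda>(u, v). u @ v"]) (auto simp: strs_def)
  then have "(\<Sum>w\<in>strs (k + l). case (take k w, drop k w) of (u, v) \<Rightarrow> g u v) = (\<Sum>(u, v)\<in>strs k \<times> strs l. g u v)"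
    by (rule sum.reindex_bij_betw)
  then show ?thesis by (simp add: sum.cartesian_product)
qed

section \<open>Amplitudes of conjugate coding\<close>

lemma amp_Cons:
  "amp \<theta> (a # z) (b # u) =
     (if \<theta> then (if b \<and> a then -1 else 1) / complex_of_real (sqrt 2) else of_bool (b = a)) * amp \<theta> z u"
proof (cases \<theta>)
  case True
  have "(\<Prod>i<length (a # z). if (b # u) ! i \<and> (a # z) ! i then - 1 else (1::complex))
    = (if b \<and> a then -1 else 1) * (\<Prod>i<length z. if u ! i \<and> z ! i then -1 else 1)"
    by (simp only: length_Cons prod.lessThan_Suc_shift) simp
  then show ?thesis using True unfolding amp_def by simp
qed (auto simp: amp_def)

lemma cnj_amp [simp]: "cnj (amp \<theta> z u) = amp \<theta> z u"
  unfolding amp_def by (auto simp: if_distrib[of cnj] cong: if_cong)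

text \<open>The inner product of product states is the product of the single-qubit inner products,
  so induction on the length reduces the claim to one qubit.\<close>

lemma amp_orthonormal:
  assumes "length z = k" "length z' = k"
  shows "(\<Sum>u\<in>strs k. amp \<theta> z u * cnj (amp \<theta> z' u)) = of_bool (z = z')"
  using assms
proof (induction k arbitrary: z z')
  case 0
  then show ?case by (simp add: strs_def amp_def)
next
  case (Suc k)
  from Suc.prems obtain a y a' y' where z: "z = a # y" "z' = a' # y'"
    and len: "length y = k" "length y' = k"
    by (metis length_Suc_conv)
  have half: "complex_of_real (sqrt 2) * complex_of_real (sqrt 2) = 2"
    by (simp flip: of_real_mult)
  let ?g = "\<lambda>a b. if \<theta> then (if b \<and> a then -1 else 1) / complex_of_real (sqrt 2) else of_bool (b = a)"
  have "(\<Sum>u\<in>strs (Suc k). amp \<theta> z u * cnj (amp \<theta> z' u))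
    = (?g a False * ?g a' False + ?g a True * ?g a' True) * (\<Sum>u\<in>strs k. amp \<theta> y u * cnj (amp \<theta> y' u))"
    unfolding z sum_strs_Suc cnj_amp amp_Cons
    by (simp only: distrib_right distrib_left sum_distrib_left sum_distrib_right mult_ac)
  \<comment> \<open>In the Hadamard basis the two terms are each one half for equal bits and cancel
    for distinct bits.\<close>
  also have "?g a False * ?g a' False + ?g a True * ?g a' True = of_bool (a = a')"
    by (auto simp: half)
  finally show ?case unfolding Suc.IH[OF len] z by simp
qed

section \<open>Guessing a preimage with Hadamard gates\<close>

text \<open>Before gate \<open>k\<close> acts, qubit \<open>k\<close> still holds the bit of
  \<open>a\<close>, so each amplitude receives a contribution from only one basis state. Nothing
  interferes, and squared moduli can be followed without the signs.\<close>

lemma run_hadamards: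
  assumes a: "a < 2 ^ m" and "k \<le> m" and "r < 2 ^ m"
  shows "(cmod (fold (apply_gate m) (map Had [0..<k]) (\<lambda>r. if r = a then 1 else 0) r))\<^sup>2
     = (if \<forall>j. k \<le> j \<and> j < m \<longrightarrow> bit r j = bit a j then 1 / 2 ^ k else 0)"
  using assms(2,3)
proof (induction k arbitrary: r)
  case 0
  have "r = a \<longleftrightarrow> (\<forall>j. 0 \<le> j \<and> j < m \<longrightarrow> bit r j = bit a j)"
    using nat_eq_if_bits_eq[OF 0(2) a] by blast
  then show ?case by simp
next
  case (Suc k)
  define \<psi> where "\<psi> = fold (apply_gate m) (map Had [0..<k]) (\<lambda>r. if r = a then 1 else 0)"
  have IH: "(cmod (\<psi> c))\<^sup>2 = (if \<forall>j. k \<le> j \<and> j < m \<longrightarrow> bit c j = bit a j then 1 / 2 ^ k else 0)"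
    if "c < 2 ^ m" for c
    using Suc.IH[of c] Suc.prems that unfolding \<psi>_def by simp
  \<comment> \<open>The only possible source of amplitude at \<open>r\<close>: the gate forces
    agreement with \<open>r\<close> off bit \<open>k\<close>, and the state so far forces bit
    \<open>k\<close> to be that of \<open>a\<close>.\<close>
  obtain c0 :: nat where c0: "c0 < 2 ^ m" "\<And>j. j < m \<Longrightarrow> bit c0 j = (if j = k then bit a k else bit r j)"
    using exists_nat_with_bits[of m "\<lambda>j. if j = k then bit a k else bit r j"] by blast
  have zero: "gate_entry m (Had k) r c * \<psi> c = 0" if "c < 2 ^ m" "c \<noteq> c0" for c
  proof (cases "(\<forall>j<m. j \<noteq> k \<longrightarrow> bit r j = bit c j)")
    case True
    have "bit c k \<noteq> bit a k"
    proof
      assume "bit c k = bit a k"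
      with True have "bit c j = bit c0 j" if "j < m" for j
        using c0(2)[OF that] that by (cases "j = k") simp_all
      then show False using nat_eq_if_bits_eq[OF that(1) c0(1)] that(2) by blast
    qed
    then have "\<not> (\<forall>j. k \<le> j \<and> j < m \<longrightarrow> bit c j = bit a j)"
      using Suc.prems by (metis Suc_le_eq order_refl)
    then have "(cmod (\<psi> c))\<^sup>2 = 0" using IH[OF that(1)] by simp
    then have "\<psi> c = 0" by simp
    then show ?thesis by simp
  qed (auto simp: bitof_eq_bit)
  have "fold (apply_gate m) (map Had [0..<Suc k]) (\<lambda>r. if r = a then 1 else 0) r
      = (\<Sum>c<2 ^ m. gate_entry m (Had k) r c * \<psi> c)"
    by (simp add: \<psi>_def apply_gate_def)
  also have "\<dots> = (\<Sum>c\<in>{c0}. gate_entry m (Had k) r c * \<psi> c)"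
    using zero c0(1) by (intro sum.mono_neutral_right) auto
  finally have fin: "fold (apply_gate m) (map Had [0..<Suc k]) (\<lambda>r. if r = a then 1 else 0) r
      = gate_entry m (Had k) r c0 * \<psi> c0"
    by simp
  have agree: "(\<forall>j. k \<le> j \<and> j < m \<longrightarrow> bit c0 j = bit a j) \<longleftrightarrow> (\<forall>j. Suc k \<le> j \<and> j < m \<longrightarrow> bit r j = bit a j)"
  proof -
    have "(bit c0 j = bit a j) \<longleftrightarrow> (j = k \<or> bit r j = bit a j)" if "j < m" for j
      using c0(2)[OF that] by auto
    moreover have "Suc k \<le> j \<longleftrightarrow> k \<le> j \<and> j \<noteq> k" for j by linarith
    ultimately show ?thesis by blast
  qed
  have "(cmod (fold (apply_gate m) (map Had [0..<Suc k]) (\<lambda>r. if r = a then 1 else 0) r))\<^sup>2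
      = (cmod (\<psi> c0))\<^sup>2 / 2"
  proof -
    have "gate_entry m (Had k) r c0 = (if bit r k \<and> bit c0 k then -1 else 1) / complex_of_real (sqrt 2)"
      using c0(2) by (simp add: bitof_eq_bit)
    then have "cmod (gate_entry m (Had k) r c0) = 1 / sqrt 2"
      by (simp add: norm_divide)
    then show ?thesis
      using fin by (simp add: norm_mult power_mult_distrib power_divide)
  qed
  also have "\<dots> = (if \<forall>j. Suc k \<le> j \<and> j < m \<longrightarrow> bit r j = bit a j then 1 / 2 ^ Suc k else 0)"
    using IH[OF c0(1)] unfolding agree by simp
  finally show ?case .
qed

text \<open>On any basis input every outcome has the same probability, so this adversary ignores its
  challenge.\<close>

definition guess_circ :: "nat \<Rightarrow> qcirc" where
  "guess_circ n = \<lparr>qubits = n, gates = map Had [0..<n]\<rparr>"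

lemma wf_guess_circ: "wf_circ n n (guess_circ n)"
  by (auto simp: wf_circ_def guess_circ_def)

lemma poly_size_guess_circ: "poly_size guess_circ"
proof -
  have "csize (guess_circ n) \<le> (n + 2) ^ 2" for n
    by (simp add: csize_def guess_circ_def power2_eq_square)
  then show ?thesis unfolding poly_size_def by blast
qed

lemma idx_less: "idx xs < 2 ^ length xs"
proof -
  have "idx xs \<le> (\<Sum>i<length xs. 2 ^ i)"
    unfolding idx_def by (intro sum_mono) auto
  also have "\<dots> < 2 ^ length xs"
    by (simp add: lessThan_atLeast0 sum_power2 flip: mask_eq_sum_exp)
  finally show ?thesis .
qed

lemma out_prob_guess_circ:
  assumes "y \<in> strs n" "z \<in> strs n"
  shows "out_prob (guess_circ n) y z = 1 / 2 ^ n"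
proof -
  obtain r0 where r0: "r0 < 2 ^ n" "bitsof n r0 = z"
    using bij_betw_bitsof[of n] assms(2) by (metis bij_betw_imp_surj_on imageE lessThan_iff)
  have "{r. r < 2 ^ n \<and> take (length z) (bitsof n r) = z} = {r0}"
    using r0 assms(2) bij_betw_bitsof[of n] unfolding bij_betw_def inj_on_def
    by (auto simp: strs_def)
  then show ?thesis
    using run_hadamards[of "idx y" n n r0] idx_less[of y] r0 assms
    by (simp add: out_prob_def guess_circ_def run_def strs_def)
qed

section \<open>Fibers and the success of a uniform guess\<close>

definition fiber :: "(nat \<Rightarrow> bool list \<Rightarrow> bool list) \<Rightarrow> nat \<Rightarrow> bool list \<Rightarrow> bool list set" where
  "fiber f n x = {z \<in> strs n. f n z = f n x}"

text \<open>Given \<open>x\<close>, a uniform guess succeeds exactly when it falls in the fiber of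
  \<open>x\<close>. One factor \<open>2 ^ n\<close> of the denominator comes from the guess, the
  other from averaging over \<open>x\<close>.\<close>

lemma inv_succ_guess_circ:
  assumes "f n ` strs n \<subseteq> strs n"
  shows "inv_succ f guess_circ n = (\<Sum>x\<in>strs n. real (card (fiber f n x))) / 4 ^ n"
proof -
  have "(\<Sum>z\<in>strs n. if f n z = f n x then out_prob (guess_circ n) (f n x) z else 0)
    = real (card (fiber f n x)) / 2 ^ n" if "x \<in> strs n" for x
  proof -
    have "(\<Sum>z\<in>strs n. if f n z = f n x then out_prob (guess_circ n) (f n x) z else 0)
      = (\<Sum>z\<in>strs n. if f n z = f n x then 1 / 2 ^ n else 0)"
      using assms that by (intro sum.cong refl) (auto simp: out_prob_guess_circ)
    also have "\<dots> = (\<Sum>z\<in>fiber f n x. 1 / 2 ^ n)"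
      unfolding fiber_def by (rule sum.inter_filter[symmetric]) simp
    finally show ?thesis by simp
  qed
  then have "inv_succ f guess_circ n = (\<Sum>x\<in>strs n. real (card (fiber f n x)) / 2 ^ n) / 2 ^ n"
    by (simp add: inv_succ_def)
  also have "\<dots> = (\<Sum>x\<in>strs n. real (card (fiber f n x))) / (2 ^ n * 2 ^ n)"
    by (simp add: sum_divide_distrib)
  also have "(2::real) ^ n * 2 ^ n = 4 ^ n" by (simp flip: power_mult_distrib)
  finally show ?thesis .
qed

text \<open>The form in which security is exploited: a set of inputs with uniformly large fibers
  already forces a success probability. It is applied to all strings and to one fiber class.\<close>

lemma inv_succ_guess_circ_ge:
  assumes maps: "f n ` strs n \<subseteq> strs n"
    and T: "T \<subseteq> strs n" and m: "\<And>x. x \<in> T \<Longrightarrow> m \<le> real (card (fiber f n x))"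
  shows "real (card T) * m / 4 ^ n \<le> inv_succ f guess_circ n"
proof -
  have "real (card T) * m = (\<Sum>x\<in>T. m)" by simp
  also have "\<dots> \<le> (\<Sum>x\<in>T. real (card (fiber f n x)))" using m by (rule sum_mono)
  also have "\<dots> \<le> (\<Sum>x\<in>strs n. real (card (fiber f n x)))"
    using T by (intro sum_mono2) auto
  finally show ?thesis
    unfolding inv_succ_guess_circ[of f n, OF maps] by (simp add: divide_right_mono)
qed

lemma card_fiber_pos: "x \<in> strs n \<Longrightarrow> 0 < card (fiber f n x)"
  by (auto simp: card_gt_0_iff fiber_def)

lemma card_fiber_le: "card (fiber f n x) \<le> 2 ^ n"
  using card_mono[of "strs n" "fiber f n x"] by (auto simp: fiber_def)

section \<open>Collisions and the distance to the maximally mixed state\<close>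

lemma length_hash:
  "pairwise_indep L a b E \<Longrightarrow> d \<in> strs L \<Longrightarrow> x \<in> strs a \<Longrightarrow> length (E d x) = b"
  unfolding pairwise_indep_def by simp

text \<open>There are \<open>2 ^ b\<close> possible common values, each attained by both inputs with
  probability \<open>2 ^ - (2 * b)\<close>.\<close>

lemma card_hash_collisions:
  assumes H: "pairwise_indep L a b E" and x: "x \<in> strs a" "x' \<in> strs a" "x \<noteq> x'"
  shows "real (card {d \<in> strs L. E d x = E d x'}) = 2 ^ L / 2 ^ b"
proof -
  have "E d x' \<in> strs b" if "d \<in> strs L" for d
    using length_hash[OF H that x(2)] by (simp add: strs_def)
  then have "{d \<in> strs L. E d x = E d x'} = (\<Union>y\<in>strs b. {d \<in> strs L. E d x = y \<and> E d x' = y})"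
    by auto
  also have "card \<dots> = (\<Sum>y\<in>strs b. card {d \<in> strs L. E d x = y \<and> E d x' = y})"
    by (rule card_UN_disjoint) auto
  finally have "real (card {d \<in> strs L. E d x = E d x'})
      = (\<Sum>y\<in>strs b. real (card {d \<in> strs L. E d x = y \<and> E d x' = y}))" by simp
  also have "\<dots> = (\<Sum>y\<in>strs b. 2 ^ L / 2 ^ (2 * b))"
  proof (rule sum.cong[OF refl])
    fix y assume "y \<in> strs b"
    then have "real (card {d \<in> strs L. E d x = y \<and> E d x' = y}) / 2 ^ L = 1 / 2 ^ (2 * b)"
      using H x unfolding pairwise_indep_def by blast
    then show "real (card {d \<in> strs L. E d x = y \<and> E d x' = y}) = 2 ^ L / 2 ^ (2 * b)"
      by (simp add: field_simps)
  qed
  also have "\<dots> = 2 ^ L / 2 ^ b"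
    by (simp add: power_add mult_2)
  finally show ?thesis .
qed

lemma card_strs_Collect_le: "real (card {d \<in> strs L. P d}) \<le> 2 ^ L"
proof -
  have "card {d \<in> strs L. P d} \<le> card (strs L)" by (rule card_mono) auto
  then show ?thesis by (simp flip: of_nat_le_iff)
qed

text \<open>The strings contain the hash descriptions, so a collision forces equal \<open>d1\<close>
  and equal \<open>d2\<close>, and for fixed inputs the two counts multiply. The three summands
  bound the three cases: equal inputs; distinct inputs in one fiber of \<open>g\<close>, where only
  \<open>h2\<close> can separate; and distinct images, where both hashes collide with their
  pairwise-independent probabilities.\<close>

lemma card_joint_collisions:
  fixes g :: "bool list \<Rightarrow> bool list"
  assumes H1: "pairwise_indep l1 n b1 h1" and H2: "pairwise_indep l2 n b2 h2"
    and G: "G \<subseteq> strs n" "g ` G \<subseteq> strs n"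
    and K: "\<And>x. x \<in> G \<Longrightarrow> real (card {x' \<in> G. g x' = g x}) \<le> K"
  defines "A \<equiv> G \<times> strs l1 \<times> strs l2"
    and "z \<equiv> \<lambda>(x, d1, d2). (d1 @ h1 d1 (g x), d2 @ h2 d2 x)"
  shows "real (card {(a, b). a \<in> A \<and> b \<in> A \<and> z a = z b})
    \<le> 2 ^ l1 * 2 ^ l2 * (real (card G) + real (card G) * K / 2 ^ b2 + (real (card G))\<^sup>2 / (2 ^ b1 * 2 ^ b2))"
proof -
  have finG: "finite G" using G(1) finite_subset by fastforce
  let ?C1 = "\<lambda>x x'. {d \<in> strs l1. h1 d (g x) = h1 d (g x')}"
  let ?C2 = "\<lambda>x x'. {d \<in> strs l2. h2 d x = h2 d x'}"
  let ?S = "SIGMA p:G \<times> G. ?C1 (fst p) (snd p) \<times> ?C2 (fst p) (snd p)"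
  have "{(a, b). a \<in> A \<and> b \<in> A \<and> z a = z b}
      = (\<lambda>((x, x'), d1, d2). ((x, d1, d2), (x', d1, d2))) ` ?S" (is "?P = ?F ` ?S")
  proof (intro equalityI subsetI)
    fix p assume "p \<in> ?P"
    then obtain x d1 d2 x' d1' d2' where p: "p = ((x, d1, d2), (x', d1', d2'))"
      and m: "x \<in> G" "x' \<in> G" "d1 \<in> strs l1" "d2 \<in> strs l2" "d1' \<in> strs l1" "d2' \<in> strs l2"
      and e: "d1 @ h1 d1 (g x) = d1' @ h1 d1' (g x')" "d2 @ h2 d2 x = d2' @ h2 d2' x'"
      unfolding A_def z_def by auto
    have "d1 = d1' \<and> h1 d1 (g x) = h1 d1 (g x')" "d2 = d2' \<and> h2 d2 x = h2 d2 x'"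
      using m e by (auto simp: strs_def)
    then have "((x, x'), d1, d2) \<in> ?S" "p = ?F ((x, x'), d1, d2)" using m p by auto
    then show "p \<in> ?F ` ?S" by blast
  qed (auto simp: A_def z_def)
  moreover have "inj_on ?F ?S" by (auto simp: inj_on_def)
  ultimately have "card ?P = card ?S" by (simp add: card_image)
  also have "\<dots> = (\<Sum>p\<in>G \<times> G. card (?C1 (fst p) (snd p)) * card (?C2 (fst p) (snd p)))"
    using finG by (subst card_SigmaI) (auto simp: card_cartesian_product)
  finally have "real (card ?P) = (\<Sum>x\<in>G. \<Sum>x'\<in>G. real (card (?C1 x x')) * real (card (?C2 x x')))"
    by (simp add: sum.cartesian_product case_prod_beta)
  also have "\<dots> \<le> (\<Sum>x\<in>G. \<Sum>x'\<in>G. 2 ^ l1 * 2 ^ l2 *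
       (of_bool (x' = x) + of_bool (g x' = g x) / 2 ^ b2 + 1 / (2 ^ b1 * 2 ^ b2)))"
  proof (intro sum_mono)
    fix x x' assume x: "x \<in> G" "x' \<in> G"
    let ?R = "2 ^ l1 * 2 ^ l2 * (of_bool (x' = x) + of_bool (g x' = g x) / 2 ^ b2 + 1 / (2 ^ b1 * 2 ^ b2)) :: real"
    consider "x' = x" | "x' \<noteq> x" "g x' = g x" | "g x' \<noteq> g x" by blast
    then show "real (card (?C1 x x')) * real (card (?C2 x x')) \<le> ?R"
    proof cases
      case 1
      have "real (card (?C1 x x')) * real (card (?C2 x x')) \<le> 2 ^ l1 * 2 ^ l2"
        by (intro mult_mono card_strs_Collect_le) auto
      also have "\<dots> = 2 ^ l1 * 2 ^ l2 * 1" by simp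
      also have "\<dots> \<le> ?R" using 1 by (intro mult_left_mono) auto
      finally show ?thesis .
    next
      case 2
      have "real (card (?C1 x x')) * real (card (?C2 x x')) \<le> 2 ^ l1 * (2 ^ l2 / 2 ^ b2)"
        using 2 x G by (intro mult_mono card_strs_Collect_le
            eq_refl[OF card_hash_collisions[OF H2]]) auto
      also have "\<dots> = 2 ^ l1 * 2 ^ l2 * (1 / 2 ^ b2)" by simp
      also have "\<dots> \<le> ?R" using 2 by (intro mult_left_mono) auto
      finally show ?thesis .
    next
      case 3
      then have "x \<noteq> x'" by auto
      then have "real (card (?C1 x x')) * real (card (?C2 x x')) = 2 ^ l1 / 2 ^ b1 * (2 ^ l2 / 2 ^ b2)"
        using 3 x G card_hash_collisions[OF H1, of "g x" "g x'"] card_hash_collisions[OF H2, of x x']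
        by (simp add: image_subset_iff subset_iff)
      also have "\<dots> = 2 ^ l1 * 2 ^ l2 * (1 / (2 ^ b1 * 2 ^ b2))" by simp
      also have "\<dots> \<le> ?R" by (intro mult_left_mono) auto
      finally show ?thesis .
    qed
  qed
  also have "\<dots> = 2 ^ l1 * 2 ^ l2 * (\<Sum>x\<in>G. 1 + real (card {x' \<in> G. g x' = g x}) / 2 ^ b2 + real (card G) / (2 ^ b1 * 2 ^ b2))"
    unfolding sum_distrib_left[symmetric]
  proof (intro arg_cong2[where f = "(*)"] refl sum.cong)
    fix x assume x: "x \<in> G"
    have *: "(\<Sum>x'\<in>G. of_bool (P x')) = real (card {x' \<in> G. P x'})" for P
      using finG by (simp add: sum_of_bool_eq Collect_conj_eq)
    have "{x' \<in> G. x' = x} = {x}" using x by auto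
    then show "(\<Sum>x'\<in>G. of_bool (x' = x) + of_bool (g x' = g x) / 2 ^ b2 + 1 / (2 ^ b1 * 2 ^ b2))
        = 1 + real (card {x' \<in> G. g x' = g x}) / 2 ^ b2 + real (card G) / (2 ^ b1 * 2 ^ b2)"
      by (simp add: sum.distrib * flip: sum_divide_distrib)
  qed
  also have "\<dots> \<le> 2 ^ l1 * 2 ^ l2 * (\<Sum>x\<in>G. 1 + K / 2 ^ b2 + real (card G) / (2 ^ b1 * 2 ^ b2))"
    using K by (intro mult_left_mono sum_mono add_mono divide_right_mono) auto
  also have "\<dots> = 2 ^ l1 * 2 ^ l2 * (real (card G) + real (card G) * K / 2 ^ b2 + (real (card G))\<^sup>2 / (2 ^ b1 * 2 ^ b2))"
    by (simp add: algebra_simps power2_eq_square)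
  finally show ?thesis .
qed

section \<open>Bob's state compared with the maximally mixed state\<close>

lemma sum_bitsof:
  "(\<Sum>r<2 ^ (k + l). g (take k (bitsof (k + l) r)) (drop k (bitsof (k + l) r)))
     = (\<Sum>u\<in>strs k. \<Sum>v\<in>strs l. g u v)"
  unfolding sum_strs_append[symmetric]
  by (rule sum.reindex_bij_betw[OF bij_betw_bitsof])

text \<open>After normalization the quadratic term of the collision count contributes exactly 1,
  which the maximally mixed state cancels. The other two terms remain, and the bound does not depend
  on \<open>w1\<close> and \<open>w2\<close> since both bases are orthonormal.\<close>

lemma bob_rho_near_maximally_mixed:
  assumes H1: "pairwise_indep (L1 n (t - D1)) n (t - D1) (E1 n (t - D1))"
    and H2: "pairwise_indep (L2 n (n - t - D2)) n (n - t - D2) (E2 n (n - t - D2))"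
    and G: "G \<subseteq> strs n" "f n ` G \<subseteq> strs n" "G \<noteq> {}"
    and K: "\<And>x. x \<in> G \<Longrightarrow> real (card {x' \<in> G. f n x' = f n x}) \<le> K"
  defines "d \<equiv> 2 ^ bob_dim L1 L2 n t D1 D2"
  shows "real d * (\<Sum>r<d. \<Sum>c<d.
       (cmod (bob_rho f L1 E1 L2 E2 n t D1 D2 G w1 w2 r c - of_bool (r = c) / of_nat d))\<^sup>2)
     \<le> 2 ^ (t - D1) * (2 ^ (n - t - D2) + K) / real (card G)"
proof -
  define b1 b2 where b: "b1 = t - D1" "b2 = n - t - D2"
  define l1 l2 where l: "l1 = L1 n b1" "l2 = L2 n b2"
  \<comment> \<open>\<open>A\<close> is the space of Alice's random choices, and \<open>z\<close>
    the pair of classical strings that she encodes.\<close>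
  define A where "A = G \<times> strs l1 \<times> strs l2"
  define z where "z = (\<lambda>(x, d1, d2). (d1 @ E1 n b1 d1 (f n x), d2 @ E2 n b2 d2 x))"
  define k1 k2 where k: "k1 = l1 + b1" "k2 = l2 + b2"
  have D: "bob_dim L1 L2 n t D1 D2 = k1 + k2"
    by (simp add: bob_dim_def b l k)
  have d: "d = 2 ^ (k1 + k2)" unfolding d_def D ..
  define \<psi> where "\<psi> = (\<lambda>a r. amp w1 (fst (z a)) (take k1 (bitsof (k1 + k2) r)) * amp w2 (snd (z a)) (drop k1 (bitsof (k1 + k2) r)))"
  have finG: "finite G" using G(1) finite_subset by fastforce
  have cardA: "card A = card G * 2 ^ l1 * 2 ^ l2"
    by (simp add: A_def card_cartesian_product)
  have finA: "finite A" and neA: "A \<noteq> {}" and G0: "card G > 0"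
  proof -
    show "card G > 0" using finG G(3) by (simp add: card_gt_0_iff)
    then have "card A > 0" using cardA by simp
    then show "finite A" "A \<noteq> {}" by (auto intro: card_ge_0_finite)
  qed
  have rho: "bob_rho f L1 E1 L2 E2 n t D1 D2 G w1 w2 r c = (\<Sum>a\<in>A. \<psi> a r * cnj (\<psi> a c)) / of_nat (card A)" for r c
  proof -
    have "bob_rho f L1 E1 L2 E2 n t D1 D2 G w1 w2 r c
      = (\<Sum>x\<in>G. \<Sum>d1\<in>strs l1. \<Sum>d2\<in>strs l2. \<psi> (x, d1, d2) r * cnj (\<psi> (x, d1, d2) c)) / of_real (real (card G) * 2 ^ l1 * 2 ^ l2)"
      unfolding bob_rho_def Let_def D b[symmetric] l[symmetric] k(1)[symmetric]
      by (simp add: \<psi>_def z_def)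
    also have "(\<Sum>x\<in>G. \<Sum>d1\<in>strs l1. \<Sum>d2\<in>strs l2. \<psi> (x, d1, d2) r * cnj (\<psi> (x, d1, d2) c)) = (\<Sum>a\<in>A. \<psi> a r * cnj (\<psi> a c))"
      unfolding A_def by (simp add: sum.cartesian_product case_prod_beta)
    finally show ?thesis by (simp add: cardA)
  qed
  have len: "length (fst (z a)) = k1" "length (snd (z a)) = k2" if aA: "a \<in> A" for a
  proof -
    obtain x d1 d2 where a: "a = (x, d1, d2)" "x \<in> G" "d1 \<in> strs l1" "d2 \<in> strs l2"
      using aA unfolding A_def by auto
    then have "x \<in> strs n" "f n x \<in> strs n" using G by auto
    then have "length (E1 n b1 d1 (f n x)) = b1" "length (E2 n b2 d2 x) = b2"
      using length_hash[OF H1[folded b, folded l] a(3)] length_hash[OF H2[folded b, folded l] a(4)]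
      by simp_all
    then show "length (fst (z a)) = k1" "length (snd (z a)) = k2"
      using a by (simp_all add: z_def k strs_def)
  qed
  have ortho: "(\<Sum>r<d. \<psi> a r * cnj (\<psi> a' r)) = of_bool (z a = z a')" if "a \<in> A" "a' \<in> A" for a a'
  proof -
    have "(\<Sum>r<d. \<psi> a r * cnj (\<psi> a' r))
      = (\<Sum>u\<in>strs k1. \<Sum>v\<in>strs k2. (amp w1 (fst (z a)) u * cnj (amp w1 (fst (z a')) u)) * (amp w2 (snd (z a)) v * cnj (amp w2 (snd (z a')) v)))"
      unfolding d sum_bitsof[symmetric] \<psi>_def by (simp add: mult_ac)
    also have "\<dots> = (\<Sum>u\<in>strs k1. amp w1 (fst (z a)) u * cnj (amp w1 (fst (z a')) u)) * (\<Sum>v\<in>strs k2. amp w2 (snd (z a)) v * cnj (amp w2 (snd (z a')) v))"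
      by (rule sum_product[symmetric])
    also have "\<dots> = of_bool (z a = z a')"
      unfolding amp_orthonormal[OF len(1)[OF that(1)] len(1)[OF that(2)]]
        amp_orthonormal[OF len(2)[OF that(1)] len(2)[OF that(2)]]
      by (simp add: prod_eq_iff)
    finally show ?thesis .
  qed
  let ?N = "real (card G) * 2 ^ l1 * 2 ^ l2"
  let ?cnt = "real (card {(a, b). a \<in> A \<and> b \<in> A \<and> z a = z b})"
  have d0: "0 < d" by (simp add: d)
  have "real d * (\<Sum>r<d. \<Sum>c<d.
       (cmod (bob_rho f L1 E1 L2 E2 n t D1 D2 G w1 w2 r c - of_bool (r = c) / of_nat d))\<^sup>2)
     = real d * (?cnt / ?N\<^sup>2 - 1 / real d)"
    unfolding rho by (subst frobenius_dist_maximally_mixed[OF finA neA d0 ortho]) (simp_all add: cardA)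
  also have "\<dots> = real d / ?N\<^sup>2 * ?cnt - 1"
    using d0 by (simp add: field_simps)
  also have "\<dots> \<le> real d / ?N\<^sup>2 * (2 ^ l1 * 2 ^ l2 * (real (card G) + real (card G) * K / 2 ^ b2 + (real (card G))\<^sup>2 / (2 ^ b1 * 2 ^ b2))) - 1"
    unfolding A_def z_def
    by (intro diff_mono mult_left_mono card_joint_collisions[OF H1[folded b, folded l] H2[folded b, folded l] G(1,2) K]) auto
  also have "\<dots> = 2 ^ b1 * (2 ^ b2 + K) / real (card G)"
    using G0 unfolding d k by (simp add: power_add power2_eq_square field_simps)
  finally show ?thesis unfolding b .
qed

lemma trace_dist_bob_rho:
  assumes H1: "pairwise_indep (L1 n (t - D1)) n (t - D1) (E1 n (t - D1))"
    and H2: "pairwise_indep (L2 n (n - t - D2)) n (n - t - D2) (E2 n (n - t - D2))"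
    and G: "G \<subseteq> strs n" "f n ` G \<subseteq> strs n" "G \<noteq> {}"
    and K: "\<And>x. x \<in> G \<Longrightarrow> real (card {x' \<in> G. f n x' = f n x}) \<le> K"
  shows "trace_dist (2 ^ bob_dim L1 L2 n t D1 D2)
       (bob_rho f L1 E1 L2 E2 n t D1 D2 G w1 w2) (bob_rho f L1 E1 L2 E2 n t D1 D2 G w1' w2')
     \<le> sqrt (2 ^ (t - D1) * (2 ^ (n - t - D2) + K) / real (card G))"
  using bob_rho_near_maximally_mixed[of L1 n t D1 E1 L2 D2 E2 G f K, OF H1 H2 G K]
  by (intro trace_dist_le_frobenius)

section \<open>Choice of the parameters\<close>

text \<open>Rounding \<open>log 2 (s n) / 4\<close> down loses less than 1, that is, a factor below
  16 in \<open>s n\<close>. The hypothesis keeps the logarithm nonnegative, so \<open>nat\<close>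
  does not truncate.\<close>

lemma Delta_bounds:
  assumes "1 \<le> s n"
  shows "2 ^ (4 * Delta s n) \<le> s n" "s n < 2 ^ (4 * Delta s n + 4)"
proof -
  have "0 \<le> log 2 (s n) / 4" using assms by simp
  then have "real (Delta s n) = of_int \<lfloor>log 2 (s n) / 4\<rfloor>"
    unfolding Delta_def by simp
  then have "real (4 * Delta s n) \<le> log 2 (s n)" "log 2 (s n) < real (4 * Delta s n + 4)"
    by linarith+
  then have "2 powr real (4 * Delta s n) \<le> s n" "s n < 2 powr real (4 * Delta s n + 4)"
    using assms by (simp_all only: le_log_iff log_less_iff)
  then show "2 ^ (4 * Delta s n) \<le> s n" "s n < 2 ^ (4 * Delta s n + 4)"
    by (simp_all only: powr_realpow zero_less_numeral)
qed

text \<open>Dyadic classes, indexed for \<open>t <= n\<close> so that the value \<open>f n x\<close>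
  has probability between \<open>2 ^ - t\<close> and twice that under a uniform input.\<close>

definition fiber_class :: "(nat \<Rightarrow> bool list \<Rightarrow> bool list) \<Rightarrow> nat \<Rightarrow> nat \<Rightarrow> bool list set" where
  "fiber_class f n t = {x \<in> strs n. 2 ^ (n - t) \<le> card (fiber f n x) \<and> card (fiber f n x) < 2 ^ (n - t + 1)}"

text \<open>Excluding fibers of full size removes the class \<open>t = 0\<close>. The remaining
  \<open>n\<close> classes cover all strings, so one has density at least
  \<open>1 / n\<close>.\<close>

lemma large_fiber_class:
  assumes nonconst: "\<And>x. x \<in> strs n \<Longrightarrow> card (fiber f n x) < 2 ^ n"
  obtains t where "1 \<le> t" "t \<le> n" "2 ^ n / real n \<le> real (card (fiber_class f n t))"
proof -
  have n: "n \<noteq> 0"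
  proof
    assume "n = 0"
    then show False using nonconst[of "[]"] card_fiber_pos[of "[]" n f] by (simp add: strs_def)
  qed
  have "strs n \<subseteq> (\<Union>t\<in>{1..n}. fiber_class f n t)"
  proof
    fix x assume x: "x \<in> strs n"
    obtain j where j: "2 ^ j \<le> card (fiber f n x)" "card (fiber f n x) < 2 ^ (j + 1)"
      using ex_power_ivl1[of 2 "card (fiber f n x)"] card_fiber_pos[OF x, of f] by auto
    have "(2::nat) ^ j < 2 ^ n" using j(1) nonconst[OF x] by linarith
    then have "j < n" by simp
    then have "x \<in> fiber_class f n (n - j)" using x j by (simp add: fiber_class_def)
    then show "x \<in> (\<Union>t\<in>{1..n}. fiber_class f n t)"
      using \<open>j < n\<close> by (intro UN_I[of "n - j"]) auto
  qed
  then have "card (strs n) \<le> card (\<Union>t\<in>{1..n}. fiber_class f n t)"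
    by (rule card_mono[rotated]) (auto simp: fiber_class_def)
  also have "\<dots> \<le> (\<Sum>t\<in>{1..n}. card (fiber_class f n t))"
    by (rule card_UN_le) simp
  finally have "real (card (strs n)) \<le> real (\<Sum>t\<in>{1..n}. card (fiber_class f n t))"
    by (rule of_nat_mono)
  then have le: "2 ^ n \<le> (\<Sum>t\<in>{1..n}. real (card (fiber_class f n t)))" by simp
  have "\<exists>t\<in>{1..n}. 2 ^ n / real n \<le> real (card (fiber_class f n t))"
  proof (rule ccontr)
    assume "\<not> ?thesis"
    then have "(\<Sum>t\<in>{1..n}. real (card (fiber_class f n t))) < (\<Sum>t\<in>{1..n}. 2 ^ n / real n)"
      using n by (intro sum_strict_mono) (auto simp: not_le)
    then show False using le n by simp
  qed
  then show thesis using that by auto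
qed

text \<open>The whole argument at a single \<open>n\<close>, with an explicit error; only the
  passage to large \<open>n\<close> is left for later.\<close>

lemma good_parameters:
  assumes maps: "f n ` strs n \<subseteq> strs n"
    and H1: "\<And>b. pairwise_indep (L1 n b) n b (E1 n b)"
    and H2: "\<And>b. pairwise_indep (L2 n b) n b (E2 n b)"
    and n: "1 \<le> n" and s1: "1 < s n" and s4: "real n ^ 4 < s n"
    and sec: "inv_succ f guess_circ n < 1 / s n"
  shows "\<exists>t0 G. 1 \<le> t0 \<and> t0 \<le> n \<and> Delta s n \<le> t0 \<and> Delta s n \<le> n - t0 \<and>
      G \<subseteq> strs n \<and> 2 ^ n / real n \<le> real (card G) \<and>
      (\<forall>w1 w2 w1' w2'. trace_dist (2 ^ bob_dim L1 L2 n t0 (Delta s n) (Delta s n))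
          (bob_rho f L1 E1 L2 E2 n t0 (Delta s n) (Delta s n) G w1 w2)
          (bob_rho f L1 E1 L2 E2 n t0 (Delta s n) (Delta s n) G w1' w2')
        \<le> sqrt (3 * real n / 2 ^ Delta s n))"
proof -
  define q where "q = Delta s n"
  note ge = inv_succ_guess_circ_ge[of f n, OF maps]
  have q: "2 ^ (4 * q) \<le> s n" unfolding q_def using Delta_bounds[of s n] s1 by simp
  have four: "(4::real) ^ n = 2 ^ n * 2 ^ n" by (simp flip: power_mult_distrib)
  have secT: "real (card T) * m * s n < 2 ^ n * 2 ^ n"
    if "T \<subseteq> strs n" "\<And>x. x \<in> T \<Longrightarrow> m \<le> real (card (fiber f n x))" for T m
  proof -
    have "real (card T) * m / 4 ^ n < 1 / s n"
      using ge[OF that] sec by linarith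
    then show ?thesis using s1 unfolding four by (simp add: field_simps)
  qed
  \<comment> \<open>A guess always succeeds with probability at least \<open>2 ^ - n\<close>; this
    gives \<open>s n < 2 ^ n\<close> and hence \<open>4 * q < n\<close>.\<close>
  have "real (card (strs n)) * 1 * s n < 2 ^ n * 2 ^ n"
  proof (rule secT)
    show "1 \<le> real (card (fiber f n x))" if "x \<in> strs n" for x
      using card_fiber_pos[OF that, of f] by linarith
  qed simp
  then have "s n < 2 ^ n" by simp
  with q have "(2::real) ^ (4 * q) < 2 ^ n" by linarith
  then have qn: "4 * q < n" by simp
  \<comment> \<open>A fiber of full size makes \<open>f n\<close> constant, so the guess succeeds
    with certainty, against \<open>1 / s n < 1\<close>.\<close>
  have nonconst: "card (fiber f n x) < 2 ^ n" if x: "x \<in> strs n" for x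
  proof (rule ccontr)
    assume "\<not> ?thesis"
    with card_fiber_le[of f n x] have "card (fiber f n x) = card (strs n)" by simp
    then have "fiber f n x = strs n"
      by (intro card_subset_eq) (auto simp: fiber_def)
    then have same: "f n z = f n x" if "z \<in> strs n" for z
      using that unfolding fiber_def by blast
    have "fiber f n y = strs n" if "y \<in> strs n" for y
      by (auto simp: fiber_def same[OF that] dest: same)
    then have "real (card (strs n)) * 2 ^ n * s n < 2 ^ n * 2 ^ n"
      by (intro secT) auto
    then show False using s1 by simp
  qed
  obtain t where t: "1 \<le> t" "t \<le> n" and big: "2 ^ n / real n \<le> real (card (fiber_class f n t))"
    using large_fiber_class[of n f, OF nonconst] by blast
  define G where "G = fiber_class f n t"
  have G: "G \<subseteq> strs n" by (auto simp: G_def fiber_class_def)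
  have pow_nt: "(2::real) ^ n = 2 ^ (n - t) * 2 ^ t" using t by (simp flip: power_add)
  \<comment> \<open>Inputs in \<open>G\<close> have weight at least \<open>1 / n\<close>, and on
    each the guess succeeds with probability at least \<open>2 ^ - t\<close>.\<close>
  have "real (card G) * 2 ^ (n - t) * s n < 2 ^ n * 2 ^ n"
    using G by (intro secT) (auto simp: G_def fiber_class_def)
  moreover have "2 ^ n / real n * 2 ^ (n - t) * s n \<le> real (card G) * 2 ^ (n - t) * s n"
    using big s1 unfolding G_def by (intro mult_right_mono) auto
  ultimately have "2 ^ n / real n * 2 ^ (n - t) * s n < 2 ^ n * (2 ^ (n - t) * 2 ^ t)"
    unfolding pow_nt[symmetric] by linarith
  then have st: "s n < real n * 2 ^ t" using n by (simp add: field_simps)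
  \<comment> \<open>Otherwise \<open>s n < n * 2 ^ q\<close>, where both factors are at most the
    fourth root of \<open>s n\<close>, so \<open>s n\<close> would be below its own square
    root.\<close>
  have qt: "q \<le> t"
  proof (rule ccontr)
    assume "\<not> q \<le> t"
    then have "real n * 2 ^ t \<le> real n * 2 ^ q" by (intro mult_left_mono) auto
    with st have "s n < real n * 2 ^ q" by linarith
    then have "s n ^ 4 < (real n * 2 ^ q) ^ 4" using s1 by (intro power_strict_mono) auto
    also have "\<dots> = real n ^ 4 * 2 ^ (4 * q)" by (simp add: power_mult_distrib power_mult mult.commute)
    also have "\<dots> \<le> s n * s n" using q s4 s1 by (intro mult_mono) auto
    also have "\<dots> \<le> s n ^ 4" using power_increasing[of 2 4 "s n"] s1 by (simp add: power2_eq_square)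
    finally show False by simp
  qed
  \<comment> \<open>From \<open>4 * q < n\<close> the cap \<open>n - q\<close> is at least 1 and at
    least \<open>q\<close>, so the minimum keeps the lower bounds valid for
    \<open>t\<close>.\<close>
  define t0 where "t0 = min t (n - q)"
  have t0: "1 \<le> t0" "t0 \<le> n" "q \<le> t0" "q \<le> n - t0" "t0 \<le> t"
    using t qn qt unfolding t0_def by auto
  have Gpos: "0 < real (card G)" using big n unfolding G_def
    by (smt (verit) divide_pos_pos of_nat_0_less_iff zero_less_power not_one_le_zero neq0_conv)
  have K: "real (card {x' \<in> G. f n x' = f n x}) \<le> 2 ^ (n - t + 1)" if "x \<in> G" for x
  proof -
    have "card {x' \<in> G. f n x' = f n x} \<le> card (fiber f n x)"
      using G by (intro card_mono) (auto simp: fiber_def)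
    also have "\<dots> \<le> 2 ^ (n - t + 1)" using that by (simp add: G_def fiber_class_def)
    finally show ?thesis by (simp only: of_nat_le_numeral_power_cancel_iff)
  qed
  \<comment> \<open>Multiplied by \<open>2 ^ q\<close>, the first term is at most
    \<open>2 ^ n\<close>, and the second is at most \<open>2 ^ (n + 1)\<close> because
    \<open>t0 <= t\<close>; this gives the 3. The factor \<open>n\<close> comes from the density of
    \<open>G\<close>.\<close>
  have bound: "2 ^ (t0 - q) * (2 ^ (n - t0 - q) + 2 ^ (n - t + 1)) / real (card G) \<le> 3 * real n / 2 ^ q"
  proof -
    have "(2::real) ^ (t0 - q) * 2 ^ (n - t0 - q) * 2 ^ q \<le> 2 ^ n"
      using t0 by (simp flip: power_add)
    moreover have "(2::real) ^ (t0 - q) * 2 ^ (n - t + 1) * 2 ^ q \<le> 2 ^ (n + 1)"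
      unfolding power_add[symmetric] using t0 t by (intro power_increasing) auto
    ultimately have "2 ^ (t0 - q) * (2 ^ (n - t0 - q) + 2 ^ (n - t + 1)) * 2 ^ q \<le> 3 * (2::real) ^ n"
      by (simp add: algebra_simps)
    also have "\<dots> \<le> 3 * (real n * real (card G))"
      using big n unfolding G_def by (simp add: field_simps)
    finally show ?thesis using Gpos by (simp add: field_simps)
  qed
  have img: "f n ` G \<subseteq> strs n" using G maps by blast
  have "G \<noteq> {}" using Gpos by auto
  have "trace_dist (2 ^ bob_dim L1 L2 n t0 q q)
          (bob_rho f L1 E1 L2 E2 n t0 q q G w1 w2) (bob_rho f L1 E1 L2 E2 n t0 q q G w1' w2')
        \<le> sqrt (3 * real n / 2 ^ q)" for w1 w2 w1' w2'
    using trace_dist_bob_rho[of L1 n t0 q E1 L2 q E2 G f, OF H1 H2 G img \<open>G \<noteq> {}\<close> K] bound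
    by (meson order_trans real_sqrt_le_mono)
  then show ?thesis using t0 G big unfolding q_def[symmetric] G_def[symmetric] by blast
qed

section \<open>From the bound at each \<open>n\<close> to negligibility\<close>

lemma negligible_sqrt_Delta:
  assumes sp: "superpoly s"
    and td: "\<forall>\<^sub>F n in sequentially. \<bar>\<epsilon> n\<bar> \<le> sqrt (3 * real n / 2 ^ Delta s n)"
  shows "negligible \<epsilon>"
  unfolding negligible_def
proof
  fix c :: nat
  \<comment> \<open>The factor 4 is undone by the fourth root in \<open>Delta\<close>. Of
    \<open>2 * c + 3\<close>, the part \<open>2 * c\<close> becomes \<open>c\<close> under the
    square root, and the 3 absorbs the factor \<open>n\<close> and the constant 6, as
    \<open>6 / n^2 <= 1\<close> for \<open>n >= 3\<close>.\<close>
  have "\<forall>\<^sub>F n in sequentially. real n ^ (4 * (2 * c + 3)) < s n"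
    using sp unfolding superpoly_def by blast
  moreover note td eventually_ge_at_top[of 3]
  ultimately show "\<forall>\<^sub>F n in sequentially. \<bar>\<epsilon> n\<bar> < 1 / real n ^ c"
  proof eventually_elim
    case (elim n)
    let ?q = "2 ^ Delta s n :: real"
    have n: "3 \<le> real n" using elim by simp
    have "1 \<le> real n ^ (4 * (2 * c + 3))" using n by (intro one_le_power) auto
    then have "real n ^ (4 * (2 * c + 3)) < 2 ^ (4 * Delta s n + 4)"
      using Delta_bounds(2)[of s n] elim by linarith
    then have "(real n ^ (2 * c + 3)) ^ 4 < (2 * ?q) ^ 4"
      by (simp add: power_mult power_mult_distrib power_add mult.commute flip: power_mult)
    then have "real n ^ (2 * c + 3) < 2 * ?q"
      by (rule power_less_imp_less_base) simp
    then have "3 * real n / ?q < 6 * real n / real n ^ (2 * c + 3)"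
      using n by (simp add: field_simps)
    also have "\<dots> = 6 / real n ^ 2 * (1 / real n ^ c)\<^sup>2"
      using n by (simp add: power_add power_mult power2_eq_square power3_eq_cube power_mult_distrib field_simps)
    also have "\<dots> \<le> 1 * (1 / real n ^ c)\<^sup>2"
    proof (rule mult_right_mono)
      have "3 ^ 2 \<le> real n ^ 2" using n by (intro power_mono) auto
      then show "6 / real n ^ 2 \<le> 1" using n by simp
    qed simp
    finally have "sqrt (3 * real n / ?q) < sqrt ((1 / real n ^ c)\<^sup>2)"
      by (intro real_sqrt_less_mono) (simp only: mult_1)
    also have "\<dots> = 1 / real n ^ c" by simp
    finally show ?case using elim by linarith
  qed
qed

theorem theorem3:
  fixes s :: "nat \<Rightarrow> real"
    and f :: "nat \<Rightarrow> bool list \<Rightarrow> bool list"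
    and L1 L2 :: "nat \<Rightarrow> nat \<Rightarrow> nat"
    and E1 E2 :: "nat \<Rightarrow> nat \<Rightarrow> bool list \<Rightarrow> bool list \<Rightarrow> bool list"
  assumes owf: "quantum_owf s f"
    and sp: "superpoly s"
    and H1: "\<And>a b. pairwise_indep (L1 a b) a b (E1 a b)"
    and H2: "\<And>a b. pairwise_indep (L2 a b) a b (E2 a b)"
  shows "\<exists>(t0 :: nat \<Rightarrow> nat) (Gam :: nat \<Rightarrow> bool list set).
           (\<forall>\<^sub>F n in sequentially.
              1 \<le> t0 n \<and> t0 n \<le> n \<and> Delta s n \<le> t0 n \<and> Delta s n \<le> n - t0 n \<and>
              Gam n \<subseteq> strs n \<and> real (card (Gam n)) \<ge> 2 ^ n / real n) \<and>
           (\<forall>w1 w2 w1' w2'. negligible (\<lambda>n.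
              trace_dist (2 ^ bob_dim L1 L2 n (t0 n) (Delta s n) (Delta s n))
                (bob_rho f L1 E1 L2 E2 n (t0 n) (Delta s n) (Delta s n) (Gam n) w1 w2)
                (bob_rho f L1 E1 L2 E2 n (t0 n) (Delta s n) (Delta s n) (Gam n) w1' w2')))"
proof -
  \<comment> \<open>The trace distance bound is included so that one choice of parameters serves
    both conclusions.\<close>
  define Good where "Good = (\<lambda>n t0 G. 1 \<le> t0 \<and> t0 \<le> n \<and> Delta s n \<le> t0 \<and> Delta s n \<le> n - t0 \<and>
      G \<subseteq> strs n \<and> 2 ^ n / real n \<le> real (card G) \<and>
      (\<forall>w1 w2 w1' w2'. trace_dist (2 ^ bob_dim L1 L2 n t0 (Delta s n) (Delta s n))
          (bob_rho f L1 E1 L2 E2 n t0 (Delta s n) (Delta s n) G w1 w2)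
          (bob_rho f L1 E1 L2 E2 n t0 (Delta s n) (Delta s n) G w1' w2')
        \<le> sqrt (3 * real n / 2 ^ Delta s n)))"
  have maps: "f n ` strs n \<subseteq> strs n" for n
    using owf unfolding quantum_owf_def by (auto simp: strs_def)
  have "\<forall>\<^sub>F n in sequentially. inv_succ f guess_circ n < 1 / s n"
    using owf poly_size_guess_circ wf_guess_circ unfolding quantum_owf_def by blast
  \<comment> \<open>Exponent 0 yields \<open>1 < s n\<close>; exponent 4 is what excludes
    \<open>t < Delta s n\<close>.\<close>
  moreover have "\<forall>\<^sub>F n in sequentially. real n ^ 0 < s n" "\<forall>\<^sub>F n in sequentially. real n ^ 4 < s n"
    using sp unfolding superpoly_def by blast+
  moreover note eventually_ge_at_top[of 1]
  ultimately have ev: "\<forall>\<^sub>F n in sequentially. \<exists>t0 G. Good n t0 G"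
  proof eventually_elim
    case (elim n)
    then show ?case
      unfolding Good_def by (intro good_parameters maps H1 H2) simp_all
  qed
  \<comment> \<open>The choice is arbitrary at those \<open>n\<close> that admit no good pair, and
    there are only finitely many of them.\<close>
  have "\<forall>n. \<exists>p. (\<exists>t0 G. Good n t0 G) \<longrightarrow> Good n (fst p) (snd p)" by auto
  then obtain p where p: "\<And>n. (\<exists>t0 G. Good n t0 G) \<longrightarrow> Good n (fst (p n)) (snd (p n))"
    by metis
  have good: "\<forall>\<^sub>F n in sequentially. Good n (fst (p n)) (snd (p n))"
    using ev by eventually_elim (use p in blast)
  show ?thesis
  proof (intro exI[of _ "\<lambda>n. fst (p n)"] exI[of _ "\<lambda>n. snd (p n)"] conjI allI)
    show "\<forall>\<^sub>F n in sequentially. 1 \<le> fst (p n) \<and> fst (p n) \<le> n \<and> Delta s n \<le> fst (p n) \<and>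
        Delta s n \<le> n - fst (p n) \<and> snd (p n) \<subseteq> strs n \<and> 2 ^ n / real n \<le> real (card (snd (p n)))"
      using good by eventually_elim (simp add: Good_def)
  next
    fix w1 w2 w1' w2'
    show "negligible (\<lambda>n. trace_dist (2 ^ bob_dim L1 L2 n (fst (p n)) (Delta s n) (Delta s n))
        (bob_rho f L1 E1 L2 E2 n (fst (p n)) (Delta s n) (Delta s n) (snd (p n)) w1 w2)
        (bob_rho f L1 E1 L2 E2 n (fst (p n)) (Delta s n) (Delta s n) (snd (p n)) w1' w2'))"
    proof (rule negligible_sqrt_Delta[OF sp])
      let ?td = "\<lambda>n. trace_dist (2 ^ bob_dim L1 L2 n (fst (p n)) (Delta s n) (Delta s n))
        (bob_rho f L1 E1 L2 E2 n (fst (p n)) (Delta s n) (Delta s n) (snd (p n)) w1 w2)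
        (bob_rho f L1 E1 L2 E2 n (fst (p n)) (Delta s n) (Delta s n) (snd (p n)) w1' w2')"
      have "0 \<le> ?td n" for n
        by (simp add: trace_dist_def trace_norm_nonneg)
      then show "\<forall>\<^sub>F n in sequentially. \<bar>?td n\<bar> \<le> sqrt (3 * real n / 2 ^ Delta s n)"
        using good by (simp add: Good_def eventually_mono)
    qed
  qed
qed

end
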